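(* Let $R$ be a finite commutative local Frobenius ring with residue field $\mathbb{F}_q$. For $i=1,2$, let $C_i$ be a free linear code of length $n$ over $R$ with generator matrix $\mathrm{G}_i$ and parity check matrix $\mathrm{H}_i$, such that $C_1+C_2=R^n$. Then the following are equivalent: (1) $C_1$ and $C_2$ form an LCP; (2) $\begin{pmatrix}\mathrm{G}_1\\ \mathrm{G}_2\end{pmatrix}$ is invertible over $R$; (3) $\begin{pmatrix}\mathrm{H}_1\\ \mathrm{H}_2\end{pmatrix}$ is invertible over $R$; (4) $\texttt{Rank}_q(\mathrm{H}_2\mathrm{G}_1^\top)=\texttt{Rank}_q(\mathrm{G}_1)$ or $\texttt{Rank}_q(\mathrm{H}_1\mathrm{G}_2^\top)=\texttt{Rank}_q(\mathrm{G}_2)$.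
   Context: A linear code of length $n$ over $R$ is an $R$-submodule of $R^n$; free means free as an $R$-module. A pair $\{C_1,C_2\}$ is a linear complementary pair (LCP) if $C_1\cap C_2=\{\mathbf{0}\}$ and $C_1+C_2=R^n$. A generator matrix of a free code is a matrix whose rows form a basis of the code; a parity check matrix of $C$ is a generator matrix of $C^\perp$ with respect to the standard inner product $\sum_j u_jc_j$. For a matrix $\mathrm{A}$ over $R$, $\texttt{Rank}_q(\mathrm{A}):=\log_q|M|$ where $M$ is the $R$-submodule spanned by the rows of $\mathrm{A}$. *)

theory Defs
  imports Complex_Main "Jordan_Normal_Form.Matrix"
begin

section \<open>Ideals of a commutative ring (type-class idiom)\<close>

definition is_ideal :: "'a::comm_ring_1 set \<Rightarrow> bool" where
  "is_ideal I \<longleftrightarrow> 0 \<in> I \<and> (\<forall>x\<in>I. \<forall>y\<in>I. x + y \<in> I) \<and> (\<forall>r. \<forall>x\<in>I. r * x \<in> I)"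

definition maximal_ideal :: "'a::comm_ring_1 set \<Rightarrow> bool" where
  "maximal_ideal M \<longleftrightarrow> is_ideal M \<and> M \<noteq> UNIV \<and>
     (\<forall>J. is_ideal J \<and> M \<subseteq> J \<longrightarrow> J = M \<or> J = UNIV)"

definition minimal_ideal :: "'a::comm_ring_1 set \<Rightarrow> bool" where
  "minimal_ideal I \<longleftrightarrow> is_ideal I \<and> I \<noteq> {0} \<and>
     (\<forall>J. is_ideal J \<and> J \<subseteq> I \<longrightarrow> J = {0} \<or> J = I)"

text \<open>A local ring: a commutative ring with exactly one maximal ideal.\<close>
definition local_ring :: "'a::comm_ring_1 itself \<Rightarrow> bool" where
  "local_ring _ \<longleftrightarrow> (\<exists>!M::'a set. maximal_ideal M)"

text \<open>A finite commutative local ring is Frobenius iff it has a unique minimal ideal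
  (equivalently its socle is simple, i.e. soc(R) is isomorphic to R/m).\<close>
definition local_frobenius :: "'a::comm_ring_1 itself \<Rightarrow> bool" where
  "local_frobenius _ \<longleftrightarrow> (\<exists>!I::'a set. minimal_ideal I)"

text \<open>The maximal ideal of a local ring and the size q of its residue field R/m.\<close>
definition max_ideal :: "'a::comm_ring_1 itself \<Rightarrow> 'a set" where
  "max_ideal _ = (THE M::'a set. maximal_ideal M)"

definition residue_card :: "'a::comm_ring_1 itself \<Rightarrow> nat" where
  "residue_card T = card {{x + m | m. m \<in> max_ideal T} | x::'a. True}"

section \<open>Linear codes over R\<close>

definition linear_code :: "nat \<Rightarrow> 'a::comm_ring_1 vec set \<Rightarrow> bool" where
  "linear_code n C \<longleftrightarrow> C \<subseteq> carrier_vec n \<and> 0\<^sub>v n \<in> C \<and>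
     (\<forall>x\<in>C. \<forall>y\<in>C. x + y \<in> C) \<and> (\<forall>r. \<forall>x\<in>C. r \<cdot>\<^sub>v x \<in> C)"

text \<open>The R-submodule spanned by the rows of A.\<close>
definition row_module :: "'a::comm_ring_1 mat \<Rightarrow> 'a vec set" where
  "row_module A = {transpose_mat A *\<^sub>v c | c. c \<in> carrier_vec (dim_row A)}"

text \<open>G is a generator matrix of C: its rows form a basis of C
  (they span C and are R-linearly independent).\<close>
definition generator_matrix :: "nat \<Rightarrow> 'a::comm_ring_1 mat \<Rightarrow> 'a vec set \<Rightarrow> bool" where
  "generator_matrix n G C \<longleftrightarrow> dim_col G = n \<and> row_module G = C \<and>
     (\<forall>c \<in> carrier_vec (dim_row G). transpose_mat G *\<^sub>v c = 0\<^sub>v n \<longrightarrow> c = 0\<^sub>v (dim_row G))"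

definition free_code :: "nat \<Rightarrow> 'a::comm_ring_1 vec set \<Rightarrow> bool" where
  "free_code n C \<longleftrightarrow> linear_code n C \<and> (\<exists>G. generator_matrix n G C)"

definition dual_code :: "nat \<Rightarrow> 'a::comm_ring_1 vec set \<Rightarrow> 'a vec set" where
  "dual_code n C = {u \<in> carrier_vec n. \<forall>c\<in>C. u \<bullet> c = 0}"

definition parity_check_matrix :: "nat \<Rightarrow> 'a::comm_ring_1 mat \<Rightarrow> 'a vec set \<Rightarrow> bool" where
  "parity_check_matrix n H C \<longleftrightarrow> generator_matrix n H (dual_code n C)"

definition code_sum :: "'a::comm_ring_1 vec set \<Rightarrow> 'a vec set \<Rightarrow> 'a vec set" where
  "code_sum C1 C2 = {x + y | x y. x \<in> C1 \<and> y \<in> C2}"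

definition LCP :: "nat \<Rightarrow> 'a::comm_ring_1 vec set \<Rightarrow> 'a vec set \<Rightarrow> bool" where
  "LCP n C1 C2 \<longleftrightarrow> C1 \<inter> C2 = {0\<^sub>v n} \<and> code_sum C1 C2 = carrier_vec n"

text \<open>Rank_q(A) = log_q |M|, M the row module of A.\<close>
definition Rank_q :: "nat \<Rightarrow> 'a::comm_ring_1 mat \<Rightarrow> real" where
  "Rank_q q A = log (real q) (real (card (row_module A)))"

end

(*
  In a finite local Frobenius ring R every nonunit annihilates a fixed nonzero element s of the
  minimal ideal.  Hence R-linearly independent vectors always have an entry that is a unit
  (otherwise the coefficients s, ..., s would give a nontrivial relation), and Gaussian
  elimination shows that a k x n generator matrix G of a free code maps R^n onto R^k.  Counting
  the fibres of u |-> G u gives |dual C| = |R|^(n - k), so k_i + h_i = n, where k_i and h_i are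
  the numbers of rows of G_i and H_i.

  The transpose of the stacked matrix (G1; G2) maps R^(k1 + k2) onto C1 + C2 = R^n, and it is
  injective exactly when C1 and C2 meet only in 0.  Over a finite ring a surjective linear map
  R^k -> R^n is injective iff k = n, and a square matrix with surjective transpose has a right
  inverse, hence a unit determinant, hence is invertible; so (1) and (2) both say k1 + k2 = n.
  The duals of C1 and C2 meet only in 0, so (H1; H2)^T is injective and (3) says h1 + h2 = n.
  Finally G1 maps the dual of C2 injectively onto the row module of H2 G1^T, which therefore
  has |R|^h2 elements, and its Rank_q equals Rank_q G1 iff h2 = k1; likewise for the other
  pair.  All four conditions thus reduce to k1 + k2 = n.
*)
theory Submission
  imports Defs "Jordan_Normal_Form.Determinant" "Berlekamp_Zassenhaus.Berlekamp_Type_Based"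
begin

section \<open>Finite local Frobenius rings\<close>

lemma is_ideal_UNIV: "is_ideal (UNIV :: 'a::comm_ring_1 set)"
  unfolding is_ideal_def by simp

lemma is_ideal_mult_image:
  fixes x :: "'a::comm_ring_1"
  assumes "is_ideal I"
  shows "is_ideal ((*) x ` I)"
  using assms unfolding is_ideal_def
  by (auto simp: image_iff) (metis mult_zero_right, metis distrib_left, metis mult.left_commute)

lemma is_ideal_eq_UNIV_if_one: "is_ideal I \<Longrightarrow> 1 \<in> I \<Longrightarrow> I = UNIV"
  unfolding is_ideal_def by (metis UNIV_I mult.right_neutral subsetI subset_antisym)

lemma maximal_ideal_iff_eq_max_ideal:
  assumes "local_ring TYPE('a::comm_ring_1)"
  shows "maximal_ideal (M :: 'a set) \<longleftrightarrow> M = max_ideal TYPE('a)"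
proof -
  have unique: "\<exists>!M :: 'a set. maximal_ideal M"
    using assms unfolding local_ring_def .
  then have "maximal_ideal (max_ideal TYPE('a))"
    unfolding max_ideal_def by (rule theI')
  with unique show ?thesis
    by blast
qed

lemma max_ideal_is_ideal:
  assumes "local_ring TYPE('a::comm_ring_1)"
  shows "is_ideal (max_ideal TYPE('a))" and "1 \<notin> max_ideal TYPE('a)"
proof -
  have "maximal_ideal (max_ideal TYPE('a))"
    using maximal_ideal_iff_eq_max_ideal[OF assms] by simp
  then show "is_ideal (max_ideal TYPE('a))" and "1 \<notin> max_ideal TYPE('a)"
    unfolding maximal_ideal_def by (auto dest: is_ideal_eq_UNIV_if_one)
qed

lemma nonunit_in_max_ideal:
  fixes x :: "'a::{comm_ring_1,finite}"
  assumes loc: "local_ring TYPE('a)" and nonunit: "\<not> x dvd 1"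
  shows "x \<in> max_ideal TYPE('a)"
proof -
  define A where "A = {J. is_ideal J \<and> J \<noteq> UNIV \<and> range ((*) x) \<subseteq> J}"
  have "1 \<notin> range ((*) x)"
  proof
    assume "1 \<in> range ((*) x)"
    then have "x dvd 1"
      by (auto simp: dvd_def)
    with nonunit show False ..
  qed
  then have "range ((*) x) \<in> A"
    unfolding A_def using is_ideal_mult_image[OF is_ideal_UNIV, of x] by auto
  then obtain J where J: "J \<in> A" and J_max: "\<forall>J'\<in>A. J \<subseteq> J' \<longrightarrow> J = J'"
    using finite_has_maximal[of A] by auto
  have "maximal_ideal J"
    unfolding maximal_ideal_def
  proof (intro conjI allI impI)
    show "is_ideal J" and "J \<noteq> UNIV"
      using J by (simp_all add: A_def)
    fix J' assume J': "is_ideal J' \<and> J \<subseteq> J'"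
    show "J' = J \<or> J' = UNIV"
    proof (cases "J' = UNIV")
      case False
      then have "J' \<in> A"
        using J J' unfolding A_def by auto
      then show ?thesis
        using J_max J' by blast
    qed simp
  qed
  moreover have "x \<in> J"
    using J rangeI[of "(*) x" 1] unfolding A_def by auto
  ultimately show ?thesis
    using maximal_ideal_iff_eq_max_ideal[OF loc] by blast
qed

lemma power_eventually_periodic:
  fixes x :: "'a::{monoid_mult,finite}"
  obtains a p where "p > 0" and "x ^ a = x ^ (a + p)"
proof -
  have "\<not> inj (\<lambda>p::nat. x ^ p)"
  proof
    assume "inj (\<lambda>p::nat. x ^ p)"
    then have "finite (UNIV :: nat set)"
      using finite_imageD[of "\<lambda>p::nat. x ^ p" UNIV] by simp
    then show False
      by simp
  qed
  then obtain a b where "a \<noteq> b" and "x ^ a = x ^ b"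
    unfolding inj_def by blast
  then show ?thesis
    using that by (metis less_imp_add_positive linorder_neqE_nat)
qed

lemma nonunit_nilpotent:
  fixes x :: "'a::{comm_ring_1,finite}"
  assumes loc: "local_ring TYPE('a)" and nonunit: "\<not> x dvd 1"
  obtains a where "x ^ a = 0"
proof -
  let ?M = "max_ideal TYPE('a)"
  obtain a p where "p > 0" and period: "x ^ a = x ^ (a + p)"
    using power_eventually_periodic by blast
  have "\<not> x ^ p dvd 1"
    using nonunit \<open>p > 0\<close> by (metis dvd_mult_left gr0_implies_Suc power_Suc)
  then have "x ^ p \<in> ?M"
    using nonunit_in_max_ideal[OF loc] by blast
  have "(1 - x ^ p) dvd 1"
  proof (rule ccontr)
    assume "\<not> (1 - x ^ p) dvd 1"
    then have "1 - x ^ p \<in> ?M"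
      using nonunit_in_max_ideal[OF loc] by blast
    then have "(1 - x ^ p) + x ^ p \<in> ?M"
      using \<open>x ^ p \<in> ?M\<close> max_ideal_is_ideal(1)[OF loc] unfolding is_ideal_def by blast
    then show False
      using max_ideal_is_ideal(2)[OF loc] by simp
  qed
  then obtain w where w: "1 = (1 - x ^ p) * w"
    by (rule dvdE)
  have "x ^ a * (1 - x ^ p) = x ^ a - x ^ (a + p)"
    by (simp add: right_diff_distrib power_add)
  then have "x ^ a * (1 - x ^ p) = 0"
    using period by simp
  then have "x ^ a * (1 - x ^ p) * w = 0"
    by simp
  then have "x ^ a = 0"
    by (simp add: w[symmetric] mult.assoc)
  then show ?thesis
    by (rule that)
qed

lemma mult_image_ne_if_nonunit:
  fixes x :: "'a::{comm_ring_1,finite}"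
  assumes loc: "local_ring TYPE('a)" and nonunit: "\<not> x dvd 1" and s: "s \<in> S" "s \<noteq> 0"
  shows "(*) x ` S \<noteq> S"
proof
  assume fixed: "(*) x ` S = S"
  have "s \<in> (*) (x ^ m) ` S" for m
  proof (induction m)
    case 0
    show ?case
      using s by simp
  next
    case (Suc m)
    then obtain t where "t \<in> S" and "s = x ^ m * t"
      by blast
    moreover have "t \<in> (*) x ` S"
      using \<open>t \<in> S\<close> fixed by simp
    then obtain t' where "t' \<in> S" and "t = x * t'"
      by blast
    ultimately have "s = x ^ Suc m * t'"
      by (simp add: power_Suc2 mult.assoc)
    then show ?case
      using \<open>t' \<in> S\<close> by (rule image_eqI)
  qed
  moreover obtain a where "x ^ a = 0"
    using nonunit_nilpotent[OF loc nonunit] .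
  ultimately have "s \<in> (*) 0 ` S"
    by metis
  then show False
    using s(2) by auto
qed

lemma local_frobenius_socle_element:
  assumes loc: "local_ring TYPE('a)" and frob: "local_frobenius TYPE('a)"
  obtains s :: "'a::{comm_ring_1,finite}" where "s \<noteq> 0" and "\<And>x. \<not> x dvd 1 \<Longrightarrow> s * x = 0"
proof -
  obtain S :: "'a set" where S: "minimal_ideal S"
    using frob unfolding local_frobenius_def by blast
  then have S_ideal: "is_ideal S" and "S \<noteq> {0}"
    unfolding minimal_ideal_def by auto
  then obtain s where s: "s \<in> S" "s \<noteq> 0"
    unfolding is_ideal_def by blast
  have "s * x = 0" if nonunit: "\<not> x dvd 1" for x
  proof -
    have "(*) x ` S \<subseteq> S"
      using S_ideal unfolding is_ideal_def by auto
    then have "(*) x ` S = {0} \<or> (*) x ` S = S"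
      using S is_ideal_mult_image[OF S_ideal] unfolding minimal_ideal_def by blast
    moreover have "(*) x ` S \<noteq> S"
      using mult_image_ne_if_nonunit[OF loc nonunit s] .
    moreover have "x * s \<in> (*) x ` S"
      using s(1) by (rule imageI)
    ultimately show ?thesis
      by (simp add: mult.commute)
  qed
  then show ?thesis
    using s(2) that by blast
qed

lemma residue_card_ge_2:
  assumes loc: "local_ring TYPE('a::{comm_ring_1,finite})"
  shows "2 \<le> residue_card TYPE('a)"
proof -
  let ?M = "max_ideal TYPE('a)"
  let ?coset = "\<lambda>x::'a. {x + m | m. m \<in> ?M}"
  have "0 \<in> ?M" and "1 \<notin> ?M"
    using max_ideal_is_ideal[OF loc] unfolding is_ideal_def by auto
  then have "1 \<in> ?coset 1" and "1 \<notin> ?coset 0"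
    by force+
  then have "?coset 0 \<noteq> ?coset 1"
    by blast
  then have "card {?coset 0, ?coset 1} = 2"
    by simp
  moreover have "card {?coset 0, ?coset 1} \<le> card {?coset x | x. True}"
    by (rule card_mono[OF finite]) blast
  ultimately show ?thesis
    unfolding residue_card_def by simp
qed

lemma one_less_card_UNIV: "1 < CARD('a::{comm_ring_1,finite})"
proof -
  have "card {0::'a, 1} \<le> CARD('a)"
    by (rule card_mono) auto
  then show ?thesis
    by simp
qed

section \<open>Linear maps between coordinate spaces\<close>

lemma mult_mat_vec_zero:
  fixes A :: "'a::semiring_0 mat"
  assumes "A \<in> carrier_mat m k"
  shows "A *\<^sub>v 0\<^sub>v k = 0\<^sub>v m"
  using assms by (intro eq_vecI) auto

lemma mult_mat_vec_uminus:
  fixes A :: "'a::comm_ring_1 mat"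
  assumes "v \<in> carrier_vec (dim_col A)"
  shows "A *\<^sub>v (- v) = - (A *\<^sub>v v)"
  using assms by (intro eq_vecI) (auto simp: scalar_prod_uminus_right)

lemma add_mult_mat_vec_eq_zero_iff:
  fixes A B :: "'a::comm_ring_1 mat"
  assumes "A \<in> carrier_mat n k1" and "B \<in> carrier_mat n k2"
    and "a \<in> carrier_vec k1" and "b \<in> carrier_vec k2"
  shows "A *\<^sub>v a + B *\<^sub>v b = 0\<^sub>v n \<longleftrightarrow> A *\<^sub>v a = B *\<^sub>v (- b)"
  using assms by (auto simp: mult_mat_vec_uminus vec_eq_iff eq_neg_iff_add_eq_0)

lemma mult_mat_vec_inj_on_iff:
  fixes A :: "'a::comm_ring_1 mat"
  assumes A: "A \<in> carrier_mat m k"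
  shows "inj_on ((*\<^sub>v) A) (carrier_vec k) \<longleftrightarrow> (\<forall>c\<in>carrier_vec k. A *\<^sub>v c = 0\<^sub>v m \<longrightarrow> c = 0\<^sub>v k)"
proof
  assume inj: "inj_on ((*\<^sub>v) A) (carrier_vec k)"
  show "\<forall>c\<in>carrier_vec k. A *\<^sub>v c = 0\<^sub>v m \<longrightarrow> c = 0\<^sub>v k"
  proof (intro ballI impI)
    fix c :: "'a vec"
    assume "c \<in> carrier_vec k" and "A *\<^sub>v c = 0\<^sub>v m"
    then show "c = 0\<^sub>v k"
      using inj_onD[OF inj, of c "0\<^sub>v k"] mult_mat_vec_zero[OF A] by simp
  qed
next
  assume kernel: "\<forall>c\<in>carrier_vec k. A *\<^sub>v c = 0\<^sub>v m \<longrightarrow> c = 0\<^sub>v k"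
  show "inj_on ((*\<^sub>v) A) (carrier_vec k)"
  proof (rule inj_onI)
    fix a b :: "'a vec"
    assume a: "a \<in> carrier_vec k" and b: "b \<in> carrier_vec k" and "A *\<^sub>v a = A *\<^sub>v b"
    then have "A *\<^sub>v (a - b) = 0\<^sub>v m"
      using A by (simp add: mult_minus_distrib_mat_vec)
    then have "a - b = 0\<^sub>v k"
      using kernel a b by simp
    then show "a = b"
      using a b by (auto simp: vec_eq_iff)
  qed
qed

lemma mult_mat_vec_surj_iff_inj:
  fixes A :: "'a::{comm_ring_1,finite} mat"
  assumes A: "A \<in> carrier_mat n n"
  shows "(*\<^sub>v) A ` carrier_vec n = carrier_vec n \<longleftrightarrow> inj_on ((*\<^sub>v) A) (carrier_vec n)"
proof -
  have "(*\<^sub>v) A ` carrier_vec n \<subseteq> carrier_vec n"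
    using A by auto
  then show ?thesis
    using inj_on_iff_eq_card[of "carrier_vec n" "(*\<^sub>v) A"]
      card_subset_eq[OF finite_carrier_vec, of "(*\<^sub>v) A ` carrier_vec n" n]
    by auto
qed

lemma dim_eq_if_mult_mat_vec_bij:
  fixes A :: "'a::{comm_ring_1,finite} mat"
  assumes "inj_on ((*\<^sub>v) A) (carrier_vec k)" and "(*\<^sub>v) A ` carrier_vec k = carrier_vec n"
  shows "k = n"
proof -
  have "CARD('a) ^ k = CARD('a) ^ n"
    using card_image[OF assms(1)] assms(2) by (simp add: card_carrier_vec)
  then show ?thesis
    using one_less_card_UNIV[where 'a = 'a] by simp
qed

lemma bij_betw_image_times_kernel:
  fixes A :: "'a::comm_ring_1 mat"
  assumes A: "A \<in> carrier_mat m n"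
    and sec: "\<And>y. y \<in> carrier_vec m \<Longrightarrow> sec y \<in> carrier_vec n \<and> A *\<^sub>v sec y = y"
  shows "bij_betw (\<lambda>u. (A *\<^sub>v u, u - sec (A *\<^sub>v u)))
    (carrier_vec n) (carrier_vec m \<times> {u \<in> carrier_vec n. A *\<^sub>v u = 0\<^sub>v m})"
proof (rule bij_betw_byWitness[where f' = "\<lambda>p. sec (fst p) + snd p"], goal_cases)
  case 1
  have "dim_vec (sec (A *\<^sub>v u)) = n" if "u \<in> carrier_vec n" for u
    using sec[OF mult_mat_vec_carrier[OF A that]] by (blast dest: carrier_vecD)
  then show ?case
    by (auto simp: vec_eq_iff)
next
  case 2
  have "A *\<^sub>v (sec y + z) = y" and "sec y + z - sec y = z"
    if "y \<in> carrier_vec m" and "z \<in> carrier_vec n" and "A *\<^sub>v z = 0\<^sub>v m" for y z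
    using that A sec[OF that(1)] by (auto simp: mult_add_distrib_mat_vec[of A m n] vec_eq_iff)
  then show ?case
    by auto
next
  case 3
  have "A *\<^sub>v (u - sec (A *\<^sub>v u)) = 0\<^sub>v m" if "u \<in> carrier_vec n" for u
    using that A sec by (simp add: mult_minus_distrib_mat_vec[of A m n])
  then show ?case
    using A sec by auto
next
  case 4
  show ?case
    using sec by auto
qed

lemma card_carrier_vec_eq_mult_card_kernel:
  fixes A :: "'a::{comm_ring_1,finite} mat"
  assumes A: "A \<in> carrier_mat m n" and surj: "(*\<^sub>v) A ` carrier_vec n = carrier_vec m"
  shows "CARD('a) ^ n = CARD('a) ^ m * card {u \<in> carrier_vec n. A *\<^sub>v u = 0\<^sub>v m}"
proof -
  have "\<exists>u. u \<in> carrier_vec n \<and> A *\<^sub>v u = y" if "y \<in> carrier_vec m" for y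
  proof -
    have "y \<in> (*\<^sub>v) A ` carrier_vec n"
      using surj that by simp
    then show ?thesis
      by blast
  qed
  then obtain sec where "\<And>y. y \<in> carrier_vec m \<Longrightarrow> sec y \<in> carrier_vec n \<and> A *\<^sub>v sec y = y"
    by metis
  then have "card (carrier_vec n :: 'a vec set)
      = card ((carrier_vec m :: 'a vec set) \<times> {u \<in> carrier_vec n. A *\<^sub>v u = 0\<^sub>v m})"
    by (rule bij_betw_same_card[OF bij_betw_image_times_kernel[OF A]])
  then show ?thesis
    by (simp add: card_cartesian_product card_carrier_vec)
qed

lemma vec_eq_zero_if_orthogonal:
  fixes v :: "'a::semiring_1 vec"
  assumes "v \<in> carrier_vec k" and "\<And>c. c \<in> carrier_vec k \<Longrightarrow> c \<bullet> v = 0"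
  shows "v = 0\<^sub>v k"
proof (rule eq_vecI)
  fix i
  assume "i < dim_vec (0\<^sub>v k :: 'a vec)"
  then have "i < k"
    by simp
  then show "v $ i = 0\<^sub>v k $ i"
    using assms(2)[OF unit_vec_carrier] scalar_prod_left_unit[OF assms(1)] by simp
qed (use assms(1) in simp)

lemma row_module_eq_image: "row_module A = (*\<^sub>v) A\<^sup>T ` carrier_vec (dim_row A)"
  unfolding row_module_def by auto

lemma card_row_module:
  fixes A :: "'a::{comm_ring_1,finite} mat"
  assumes "inj_on ((*\<^sub>v) A\<^sup>T) (carrier_vec (dim_row A))"
  shows "card (row_module A) = CARD('a) ^ dim_row A"
  using card_image[OF assms] by (simp add: row_module_eq_image card_carrier_vec)

section \<open>Independent vectors over a local Frobenius ring\<close>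

definition independent_vecs :: "nat \<Rightarrow> 'i set \<Rightarrow> ('i \<Rightarrow> 'a::comm_ring_1 vec) \<Rightarrow> bool" where
  "independent_vecs n I r \<longleftrightarrow> (\<forall>c. (\<forall>t<n. (\<Sum>l\<in>I. c l * r l $ t) = 0) \<longrightarrow> (\<forall>l\<in>I. c l = 0))"

lemma independent_vecs_has_unit_entry:
  fixes r :: "'i \<Rightarrow> 'a::comm_ring_1 vec" and s :: 'a
  assumes "s \<noteq> 0" and socle: "\<And>x. \<not> x dvd 1 \<Longrightarrow> s * x = 0"
    and indep: "independent_vecs n I r" and "I \<noteq> {}"
  obtains i j where "i \<in> I" and "j < n" and "r i $ j dvd 1"
proof -
  have "\<exists>i\<in>I. \<exists>j<n. r i $ j dvd 1"
  proof (rule ccontr)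
    assume no_unit: "\<not> ?thesis"
    \<comment> \<open>the socle element kills every entry, so the constant combination \<open>s\<close> is trivial\<close>
    have "(\<Sum>l\<in>I. s * r l $ t) = 0" if "t < n" for t
      using that no_unit by (intro sum.neutral ballI socle) auto
    then have "\<forall>l\<in>I. s = 0"
      using spec[OF indep[unfolded independent_vecs_def], of "\<lambda>_. s"] by blast
    then show False
      using \<open>s \<noteq> 0\<close> \<open>I \<noteq> {}\<close> by blast
  qed
  then show thesis
    using that by blast
qed

lemma independent_vecs_subtract_multiples:
  assumes indep: "independent_vecs n I r" and "finite I" and "i \<in> I"
    and carrier: "\<And>l. l \<in> I \<Longrightarrow> r l \<in> carrier_vec n"
  shows "independent_vecs n (I - {i}) (\<lambda>l. r l - a l \<cdot>\<^sub>v r i)"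
  unfolding independent_vecs_def
proof (intro allI impI ballI)
  fix c l
  assume comb: "\<forall>t<n. (\<Sum>l\<in>I - {i}. c l * (r l - a l \<cdot>\<^sub>v r i) $ t) = 0"
    and l: "l \<in> I - {i}"
  define c' where "c' = c(i := - (\<Sum>l\<in>I - {i}. c l * a l))"
  have "(\<Sum>l\<in>I. c' l * r l $ t) = 0" if "t < n" for t
  proof -
    have entry: "(r l - a l \<cdot>\<^sub>v r i) $ t = r l $ t - a l * r i $ t" if "l \<in> I" for l
      using carrier[OF that] carrier[OF \<open>i \<in> I\<close>] \<open>t < n\<close> by simp
    have "(\<Sum>l\<in>I. c' l * r l $ t) = c' i * r i $ t + (\<Sum>l\<in>I - {i}. c l * r l $ t)"
      using \<open>finite I\<close> \<open>i \<in> I\<close> by (simp add: sum.remove c'_def)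
    also have "\<dots> = (\<Sum>l\<in>I - {i}. c l * (r l - a l \<cdot>\<^sub>v r i) $ t)"
      by (simp add: c'_def entry right_diff_distrib sum_subtractf sum_distrib_right mult.assoc)
    finally show ?thesis
      using comb \<open>t < n\<close> by simp
  qed
  then have "c' l = 0"
    using indep l unfolding independent_vecs_def by blast
  then show "c l = 0"
    using l by (simp add: c'_def)
qed

lemma scalar_prod_add_smult_unit_vec:
  fixes v u :: "'a::comm_semiring_1 vec"
  assumes "v \<in> carrier_vec n" and "u \<in> carrier_vec n" and "j < n"
  shows "v \<bullet> (u + x \<cdot>\<^sub>v unit_vec n j) = v \<bullet> u + x * v $ j"
  using assms scalar_prod_smult_right[of v "unit_vec n j" x]
  by (simp add: scalar_prod_add_distrib[of _ n])

lemma pivot_extend_solution: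
  fixes r :: "'i \<Rightarrow> 'a::comm_ring_1 vec"
  assumes carrier: "\<And>l. l \<in> I \<Longrightarrow> r l \<in> carrier_vec n" and i: "i \<in> I" and j: "j < n"
    and w: "r i $ j * w = 1" and u': "u' \<in> carrier_vec n"
    and sol': "\<And>l. l \<in> I - {i} \<Longrightarrow> (r l - (r l $ j * w) \<cdot>\<^sub>v r i) \<bullet> u' = y l - r l $ j * w * y i"
  shows "\<exists>u\<in>carrier_vec n. \<forall>l\<in>I. r l \<bullet> u = y l"
proof -
  define u where "u = u' + ((y i - r i \<bullet> u') * w) \<cdot>\<^sub>v unit_vec n j"
  have ri: "r i \<in> carrier_vec n"
    using carrier i .
  have u: "u \<in> carrier_vec n"
    using u' by (simp add: u_def)
  have sol_i: "r i \<bullet> u = y i"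
    using scalar_prod_add_smult_unit_vec[OF ri u' j] w
    by (simp add: u_def mult.assoc mult.commute[of w])
  have "r l \<bullet> u = y l" if l: "l \<in> I - {i}" for l
  proof -
    let ?r' = "r l - (r l $ j * w) \<cdot>\<^sub>v r i"
    have rl: "r l \<in> carrier_vec n"
      using carrier l by simp
    have "?r' \<bullet> u = r l \<bullet> u - r l $ j * w * (r i \<bullet> u)"
      using rl ri u by (simp add: minus_scalar_prod_distrib[of _ n])
    moreover have "?r' $ j = 0"
      using rl ri j w by (simp add: mult.assoc mult.commute[of w])
    then have "?r' \<bullet> u = y l - r l $ j * w * y i"
      using scalar_prod_add_smult_unit_vec[of ?r' n u' j] rl ri u' j sol'[OF l]
      by (simp add: u_def)
    ultimately show ?thesis
      using sol_i by simp
  qed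
  then show ?thesis
    using u sol_i by blast
qed

text \<open>Gaussian elimination: pivot on a unit entry and clear its column in the other vectors.\<close>
lemma independent_vecs_solvable:
  fixes r :: "'i \<Rightarrow> 'a::comm_ring_1 vec" and s :: 'a
  assumes "s \<noteq> 0" and socle: "\<And>x. \<not> x dvd 1 \<Longrightarrow> s * x = 0"
    and "finite I" and "\<And>l. l \<in> I \<Longrightarrow> r l \<in> carrier_vec n" and "independent_vecs n I r"
  shows "\<exists>u\<in>carrier_vec n. \<forall>l\<in>I. r l \<bullet> u = y l"
  using assms(3-)
proof (induction "card I" arbitrary: I r y)
  case 0
  then show ?case
    by (intro bexI[of _ "0\<^sub>v n"]) auto
next
  case (Suc m)
  then obtain i j where i: "i \<in> I" and j: "j < n" and "r i $ j dvd 1"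
    using independent_vecs_has_unit_entry[OF \<open>s \<noteq> 0\<close> socle] by (metis card.empty nat.distinct(1))
  then obtain w where w: "r i $ j * w = 1"
    by (metis dvdE)
  have "\<exists>u'\<in>carrier_vec n. \<forall>l\<in>I - {i}. (r l - (r l $ j * w) \<cdot>\<^sub>v r i) \<bullet> u' = y l - r l $ j * w * y i"
  proof (rule Suc.hyps(1))
    show "m = card (I - {i})" and "finite (I - {i})"
      using Suc.hyps(2) Suc.prems(1) i by simp_all
    show "r l - (r l $ j * w) \<cdot>\<^sub>v r i \<in> carrier_vec n" if "l \<in> I - {i}" for l
      using Suc.prems(2) i that by simp
    show "independent_vecs n (I - {i}) (\<lambda>l. r l - (r l $ j * w) \<cdot>\<^sub>v r i)"
      by (rule independent_vecs_subtract_multiples[OF Suc.prems(3,1) i Suc.prems(2)])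
  qed
  then show ?case
    using pivot_extend_solution[where I = I and r = r, OF Suc.prems(2) i j w] by blast
qed

section \<open>Generator matrices and dual codes\<close>

lemma generator_matrix_dim_col: "generator_matrix n G C \<Longrightarrow> dim_col G = n"
  unfolding generator_matrix_def by blast

lemma generator_matrix_carrier: "generator_matrix n G C \<Longrightarrow> G \<in> carrier_mat (dim_row G) n"
  by (rule carrier_matI) (simp_all add: generator_matrix_dim_col)

lemma generator_matrix_transpose_carrier:
  "generator_matrix n G C \<Longrightarrow> G\<^sup>T \<in> carrier_mat n (dim_row G)"
  by (rule carrier_matI) (simp_all add: generator_matrix_dim_col)

lemma generator_matrix_row_module: "generator_matrix n G C \<Longrightarrow> row_module G = C"
  unfolding generator_matrix_def by blast

lemma generator_matrix_code_eq:
  "generator_matrix n G C \<Longrightarrow> C = (*\<^sub>v) G\<^sup>T ` carrier_vec (dim_row G)"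
  using generator_matrix_row_module row_module_eq_image by metis

lemma generator_matrix_kernel:
  assumes "generator_matrix n G C" and "c \<in> carrier_vec (dim_row G)" and "G\<^sup>T *\<^sub>v c = 0\<^sub>v n"
  shows "c = 0\<^sub>v (dim_row G)"
  using assms unfolding generator_matrix_def by blast

lemma generator_matrix_transpose_inj:
  assumes "generator_matrix n G C"
  shows "inj_on ((*\<^sub>v) G\<^sup>T) (carrier_vec (dim_row G))"
  using mult_mat_vec_inj_on_iff[OF generator_matrix_transpose_carrier[OF assms]]
    generator_matrix_kernel[OF assms] by blast

lemma card_code_generator_matrix:
  fixes C :: "'a::{comm_ring_1,finite} vec set"
  assumes "generator_matrix n G C"
  shows "card C = CARD('a) ^ dim_row G"
  using card_row_module[OF generator_matrix_transpose_inj[OF assms]]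
    generator_matrix_code_eq[OF assms] row_module_eq_image[of G]
  by simp

lemma generator_matrix_rows_independent:
  assumes "generator_matrix n G C"
  shows "independent_vecs n {0..<dim_row G} (row G)"
  unfolding independent_vecs_def
proof (intro allI impI)
  fix c
  assume comb: "\<forall>t<n. (\<Sum>l\<in>{0..<dim_row G}. c l * row G l $ t) = 0"
  let ?c = "vec (dim_row G) c"
  note dim_col = generator_matrix_dim_col[OF assms]
  have "G\<^sup>T *\<^sub>v ?c = 0\<^sub>v n"
  proof (rule eq_vecI)
    fix t
    assume "t < dim_vec (0\<^sub>v n :: 'a vec)"
    then have "t < n"
      by simp
    then have "(G\<^sup>T *\<^sub>v ?c) $ t = (\<Sum>l\<in>{0..<dim_row G}. G $$ (l, t) * c l)"
      using dim_col by (simp add: scalar_prod_def)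
    also have "\<dots> = (\<Sum>l\<in>{0..<dim_row G}. c l * row G l $ t)"
      using dim_col \<open>t < n\<close> by (intro sum.cong) (simp_all add: mult.commute)
    finally show "(G\<^sup>T *\<^sub>v ?c) $ t = 0\<^sub>v n $ t"
      using comb \<open>t < n\<close> by simp
  qed (use dim_col in simp)
  then have "?c = 0\<^sub>v (dim_row G)"
    using generator_matrix_kernel[OF assms] by simp
  then show "\<forall>l\<in>{0..<dim_row G}. c l = 0"
    by (auto simp: vec_eq_iff)
qed

lemma generator_matrix_mult_surj:
  fixes G :: "'a::comm_ring_1 mat" and s :: 'a
  assumes "s \<noteq> 0" and "\<And>x. \<not> x dvd 1 \<Longrightarrow> s * x = 0"
    and G: "generator_matrix n G C"
  shows "(*\<^sub>v) G ` carrier_vec n = carrier_vec (dim_row G)"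
proof
  show "(*\<^sub>v) G ` carrier_vec n \<subseteq> carrier_vec (dim_row G)"
    by (intro image_subsetI carrier_vecI) simp
  show "carrier_vec (dim_row G) \<subseteq> (*\<^sub>v) G ` carrier_vec n"
  proof
    fix y :: "'a vec"
    assume y: "y \<in> carrier_vec (dim_row G)"
    obtain u where u: "u \<in> carrier_vec n" and "\<forall>l\<in>{0..<dim_row G}. row G l \<bullet> u = y $ l"
      using independent_vecs_solvable[OF assms(1,2), of "{0..<dim_row G}" "row G" n "($) y"]
        generator_matrix_rows_independent[OF G] generator_matrix_dim_col[OF G]
      by auto
    then have "G *\<^sub>v u = y"
      using y by (intro eq_vecI) auto
    then show "y \<in> (*\<^sub>v) G ` carrier_vec n"
      using u by blast
  qed
qed

lemma dual_code_eq_kernel: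
  assumes "generator_matrix n G C"
  shows "dual_code n C = {u \<in> carrier_vec n. G *\<^sub>v u = 0\<^sub>v (dim_row G)}"
proof -
  define k where "k = dim_row G"
  have G: "G \<in> carrier_mat k n"
    unfolding k_def by (rule generator_matrix_carrier[OF assms])
  have C: "C = (*\<^sub>v) G\<^sup>T ` carrier_vec k"
    unfolding k_def by (rule generator_matrix_code_eq[OF assms])
  have "(\<forall>x\<in>C. u \<bullet> x = 0) \<longleftrightarrow> G *\<^sub>v u = 0\<^sub>v k" if u: "u \<in> carrier_vec n" for u
  proof -
    have "u \<bullet> (G\<^sup>T *\<^sub>v c) = c \<bullet> (G *\<^sub>v u)" if c: "c \<in> carrier_vec k" for c
    proof -
      have "u \<bullet> (G\<^sup>T *\<^sub>v c) = (G\<^sup>T *\<^sub>v c) \<bullet> u"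
        by (rule comm_scalar_prod[of _ n]) (use G u c in auto)
      also have "\<dots> = c \<bullet> (G *\<^sub>v u)"
        by (rule transpose_vec_mult_scalar[OF G u c])
      finally show ?thesis .
    qed
    then have "(\<forall>x\<in>C. u \<bullet> x = 0) \<longleftrightarrow> (\<forall>c\<in>carrier_vec k. c \<bullet> (G *\<^sub>v u) = 0)"
      by (simp add: C)
    also have "\<dots> \<longleftrightarrow> G *\<^sub>v u = 0\<^sub>v k"
      using vec_eq_zero_if_orthogonal[of "G *\<^sub>v u" k] G u by auto
    finally show ?thesis .
  qed
  then show ?thesis
    unfolding dual_code_def k_def by auto
qed

lemma dim_generator_add_dim_parity_check:
  fixes G H :: "'a::{comm_ring_1,finite} mat" and s :: 'a
  assumes "s \<noteq> 0" and "\<And>x. \<not> x dvd 1 \<Longrightarrow> s * x = 0"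
    and G: "generator_matrix n G C" and H: "parity_check_matrix n H C"
  shows "dim_row G + dim_row H = n"
proof -
  have "CARD('a) ^ n = CARD('a) ^ dim_row G * card (dual_code n C)"
    using card_carrier_vec_eq_mult_card_kernel[OF generator_matrix_carrier[OF G]
        generator_matrix_mult_surj[OF assms(1,2) G]]
    by (simp add: dual_code_eq_kernel[OF G])
  moreover have "card (dual_code n C) = CARD('a) ^ dim_row H"
    using card_code_generator_matrix H unfolding parity_check_matrix_def by blast
  ultimately have "CARD('a) ^ n = CARD('a) ^ (dim_row G + dim_row H)"
    by (simp add: power_add)
  then show ?thesis
    using one_less_card_UNIV[where 'a = 'a] by simp
qed

lemma dual_codes_disjoint_if_code_sum_full:
  fixes C1 C2 :: "'a::comm_ring_1 vec set"
  assumes "C1 \<subseteq> carrier_vec n" and "C2 \<subseteq> carrier_vec n" and full: "code_sum C1 C2 = carrier_vec n"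
  shows "dual_code n C1 \<inter> dual_code n C2 = {0\<^sub>v n}"
proof (intro equalityI subsetI)
  fix u :: "'a vec"
  assume "u \<in> dual_code n C1 \<inter> dual_code n C2"
  then have u: "u \<in> carrier_vec n" and "\<forall>x\<in>C1. u \<bullet> x = 0" and "\<forall>y\<in>C2. u \<bullet> y = 0"
    unfolding dual_code_def by auto
  have "v \<bullet> u = 0" if "v \<in> carrier_vec n" for v
  proof -
    have "v \<in> code_sum C1 C2"
      using that full by simp
    then obtain x y where "v = x + y" and "x \<in> C1" and "y \<in> C2"
      unfolding code_sum_def by blast
    then have x: "x \<in> carrier_vec n" and y: "y \<in> carrier_vec n"
      using assms(1,2) by auto
    have "v \<bullet> u = u \<bullet> (x + y)"
      using comm_scalar_prod[OF that u] \<open>v = x + y\<close> by simp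
    also have "\<dots> = u \<bullet> x + u \<bullet> y"
      by (rule scalar_prod_add_distrib[OF u x y])
    finally show ?thesis
      using \<open>x \<in> C1\<close> \<open>y \<in> C2\<close> \<open>\<forall>x\<in>C1. u \<bullet> x = 0\<close> \<open>\<forall>y\<in>C2. u \<bullet> y = 0\<close> by simp
  qed
  then show "u \<in> {0\<^sub>v n}"
    using vec_eq_zero_if_orthogonal[OF u] by simp
next
  fix u :: "'a vec"
  assume "u \<in> {0\<^sub>v n}"
  then show "u \<in> dual_code n C1 \<inter> dual_code n C2"
    using assms(1,2) unfolding dual_code_def by auto
qed

lemma card_row_module_mult_transpose:
  fixes G H :: "'a::{comm_ring_1,finite} mat"
  assumes G: "generator_matrix n G C" and H: "generator_matrix n H D"
    and disjoint: "dual_code n C \<inter> D = {0\<^sub>v n}"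
  shows "card (row_module (H * G\<^sup>T)) = CARD('a) ^ dim_row H"
proof -
  define k h where "k = dim_row G" and "h = dim_row H"
  have Gc: "G \<in> carrier_mat k n" and Hc: "H \<in> carrier_mat h n"
    unfolding k_def h_def by (rule generator_matrix_carrier[OF G], rule generator_matrix_carrier[OF H])
  have GH: "G * H\<^sup>T \<in> carrier_mat k h"
    using Gc Hc by simp
  have "(H * G\<^sup>T)\<^sup>T = G * H\<^sup>T"
    using transpose_mult[OF Hc, of "G\<^sup>T" k] Gc by simp
  moreover have "inj_on ((*\<^sub>v) (G * H\<^sup>T)) (carrier_vec h)"
    unfolding mult_mat_vec_inj_on_iff[OF GH]
  proof (intro ballI impI)
    fix c
    assume c: "c \<in> carrier_vec h" and "G * H\<^sup>T *\<^sub>v c = 0\<^sub>v k"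
    then have "G *\<^sub>v (H\<^sup>T *\<^sub>v c) = 0\<^sub>v k"
      using Gc Hc by simp
    then have "H\<^sup>T *\<^sub>v c \<in> dual_code n C"
      using dual_code_eq_kernel[OF G] Hc c by (simp add: k_def)
    moreover have "H\<^sup>T *\<^sub>v c \<in> D"
      using generator_matrix_code_eq[OF H] c by (simp add: h_def)
    ultimately have "H\<^sup>T *\<^sub>v c = 0\<^sub>v n"
      using disjoint by blast
    then show "c = 0\<^sub>v h"
      using generator_matrix_kernel[OF H] c by (simp add: h_def)
  qed
  ultimately show ?thesis
    using card_row_module[of "H * G\<^sup>T"] unfolding h_def by simp
qed

lemma Rank_q_eq_iff_card_eq:
  fixes A B :: "'a::{comm_ring_1,finite} mat"
  assumes "1 < q"
  shows "Rank_q q A = Rank_q q B \<longleftrightarrow> card (row_module A) = card (row_module B)"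
proof -
  have "real (card (row_module M)) \<in> {0<..}" for M :: "'a mat"
  proof -
    have "row_module M \<subseteq> carrier_vec (dim_col M)"
      unfolding row_module_eq_image by (intro image_subsetI carrier_vecI) simp
    then have "finite (row_module M)"
      using finite_carrier_vec finite_subset by blast
    moreover have "M\<^sup>T *\<^sub>v 0\<^sub>v (dim_row M) \<in> row_module M"
      unfolding row_module_def by auto
    ultimately show ?thesis
      using card_gt_0_iff by force
  qed
  then show ?thesis
    unfolding Rank_q_def using inj_on_eq_iff[OF log_inj] assms by simp
qed

section \<open>Stacked generator matrices\<close>

lemma carrier_vec_add_eq_image_append:
  "carrier_vec (k1 + k2) = (\<lambda>(a, b). a @\<^sub>v b) ` (carrier_vec k1 \<times> carrier_vec k2)"
proof (intro equalityI subsetI)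
  fix c :: "'a vec"
  assume "c \<in> carrier_vec (k1 + k2)"
  then have "c = (\<lambda>(a, b). a @\<^sub>v b) (vec_first c k1, vec_last c k2)"
    by simp
  then show "c \<in> (\<lambda>(a, b). a @\<^sub>v b) ` (carrier_vec k1 \<times> carrier_vec k2)"
    using vec_first_carrier vec_last_carrier by blast
qed auto

lemma append_rows_transpose_mult_append_vec:
  fixes A B :: "'a::comm_semiring_0 mat"
  assumes A: "A \<in> carrier_mat k1 n" and B: "B \<in> carrier_mat k2 n"
    and a: "a \<in> carrier_vec k1" and b: "b \<in> carrier_vec k2"
  shows "(A @\<^sub>r B)\<^sup>T *\<^sub>v (a @\<^sub>v b) = A\<^sup>T *\<^sub>v a + B\<^sup>T *\<^sub>v b"
proof -
  have dim: "dim_col (A @\<^sub>r B) = n"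
    using carrier_append_rows[OF A B] by auto
  show ?thesis
  proof (rule eq_vecI)
    fix t
    assume "t < dim_vec (A\<^sup>T *\<^sub>v a + B\<^sup>T *\<^sub>v b)"
    then have t: "t < n"
      using B by simp
    have "col (A @\<^sub>r B) t = col A t @\<^sub>v col B t"
      using A B t by (intro eq_vecI) (auto simp: append_rows_def)
    then show "((A @\<^sub>r B)\<^sup>T *\<^sub>v (a @\<^sub>v b)) $ t = (A\<^sup>T *\<^sub>v a + B\<^sup>T *\<^sub>v b) $ t"
      using A B dim a b t by (simp add: scalar_prod_append[of _ k1 _ k2])
  qed (use B dim in simp)
qed

lemma append_rows_transpose_image:
  fixes A B :: "'a::comm_semiring_0 mat"
  assumes A: "A \<in> carrier_mat k1 n" and B: "B \<in> carrier_mat k2 n"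
  shows "(*\<^sub>v) (A @\<^sub>r B)\<^sup>T ` carrier_vec (k1 + k2)
    = (\<lambda>(a, b). A\<^sup>T *\<^sub>v a + B\<^sup>T *\<^sub>v b) ` (carrier_vec k1 \<times> carrier_vec k2)"
  unfolding carrier_vec_add_eq_image_append image_image
  by (intro image_cong) (auto simp: append_rows_transpose_mult_append_vec[OF A B])

lemma code_sum_image:
  "code_sum (f ` A) (g ` B) = (\<lambda>(a, b). f a + g b) ` (A \<times> B)"
proof (intro equalityI subsetI)
  fix v
  assume "v \<in> code_sum (f ` A) (g ` B)"
  then obtain a b where "a \<in> A" and "b \<in> B" and "v = f a + g b"
    unfolding code_sum_def by blast
  then show "v \<in> (\<lambda>(a, b). f a + g b) ` (A \<times> B)"
    by (intro image_eqI[of _ _ "(a, b)"]) auto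
next
  fix v
  assume "v \<in> (\<lambda>(a, b). f a + g b) ` (A \<times> B)"
  then obtain a b where "a \<in> A" and "b \<in> B" and "v = f a + g b"
    by auto
  then show "v \<in> code_sum (f ` A) (g ` B)"
    unfolding code_sum_def by blast
qed

lemma code_sum_eq_image_append_rows:
  assumes G1: "generator_matrix n G1 C1" and G2: "generator_matrix n G2 C2"
  shows "code_sum C1 C2 = (*\<^sub>v) (G1 @\<^sub>r G2)\<^sup>T ` carrier_vec (dim_row G1 + dim_row G2)"
proof -
  have "code_sum C1 C2
    = (\<lambda>(a, b). G1\<^sup>T *\<^sub>v a + G2\<^sup>T *\<^sub>v b) ` (carrier_vec (dim_row G1) \<times> carrier_vec (dim_row G2))"
    by (subst generator_matrix_code_eq[OF G1], subst generator_matrix_code_eq[OF G2]) (rule code_sum_image)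
  then show ?thesis
    using append_rows_transpose_image[OF generator_matrix_carrier[OF G1] generator_matrix_carrier[OF G2]]
    by simp
qed

lemma append_rows_transpose_inj_iff:
  fixes A B :: "'a::comm_ring_1 mat"
  assumes A: "A \<in> carrier_mat k1 n" and B: "B \<in> carrier_mat k2 n"
  shows "inj_on ((*\<^sub>v) (A @\<^sub>r B)\<^sup>T) (carrier_vec (k1 + k2)) \<longleftrightarrow>
    (\<forall>a\<in>carrier_vec k1. \<forall>b\<in>carrier_vec k2. A\<^sup>T *\<^sub>v a + B\<^sup>T *\<^sub>v b = 0\<^sub>v n \<longrightarrow> a = 0\<^sub>v k1 \<and> b = 0\<^sub>v k2)"
proof -
  have zero_iff: "a @\<^sub>v b = 0\<^sub>v (k1 + k2) \<longleftrightarrow> a = 0\<^sub>v k1 \<and> b = 0\<^sub>v k2"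
    if "a \<in> carrier_vec k1" and "b \<in> carrier_vec k2" for a b :: "'a vec"
  proof -
    have "0\<^sub>v (k1 + k2) = 0\<^sub>v k1 @\<^sub>v (0\<^sub>v k2 :: 'a vec)"
      by auto
    then show ?thesis
      using append_vec_eq[OF that(1), of "0\<^sub>v k1" b "0\<^sub>v k2"] by simp
  qed
  have "(A @\<^sub>r B)\<^sup>T \<in> carrier_mat n (k1 + k2)"
    using A B by auto
  then have "inj_on ((*\<^sub>v) (A @\<^sub>r B)\<^sup>T) (carrier_vec (k1 + k2)) \<longleftrightarrow>
      (\<forall>c\<in>carrier_vec (k1 + k2). (A @\<^sub>r B)\<^sup>T *\<^sub>v c = 0\<^sub>v n \<longrightarrow> c = 0\<^sub>v (k1 + k2))"
    by (rule mult_mat_vec_inj_on_iff)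
  also have "\<dots> \<longleftrightarrow>
      (\<forall>a\<in>carrier_vec k1. \<forall>b\<in>carrier_vec k2. A\<^sup>T *\<^sub>v a + B\<^sup>T *\<^sub>v b = 0\<^sub>v n \<longrightarrow> a = 0\<^sub>v k1 \<and> b = 0\<^sub>v k2)"
    by (simp add: carrier_vec_add_eq_image_append append_rows_transpose_mult_append_vec[OF A B] zero_iff)
  finally show ?thesis .
qed

lemma append_rows_transpose_inj_if_disjoint:
  assumes G1: "generator_matrix n G1 C1" and G2: "generator_matrix n G2 C2"
    and disjoint: "C1 \<inter> C2 = {0\<^sub>v n}"
  shows "inj_on ((*\<^sub>v) (G1 @\<^sub>r G2)\<^sup>T) (carrier_vec (dim_row G1 + dim_row G2))"
  unfolding append_rows_transpose_inj_iff[OF generator_matrix_carrier[OF G1] generator_matrix_carrier[OF G2]]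
proof (intro ballI impI)
  fix a b
  assume a: "a \<in> carrier_vec (dim_row G1)" and b: "b \<in> carrier_vec (dim_row G2)"
    and sum: "G1\<^sup>T *\<^sub>v a + G2\<^sup>T *\<^sub>v b = 0\<^sub>v n"
  then have "G1\<^sup>T *\<^sub>v a = G2\<^sup>T *\<^sub>v (- b)"
    using add_mult_mat_vec_eq_zero_iff[OF generator_matrix_transpose_carrier[OF G1]
        generator_matrix_transpose_carrier[OF G2] a b] by simp
  then have "G1\<^sup>T *\<^sub>v a \<in> C2"
    using b by (subst generator_matrix_code_eq[OF G2]) (rule image_eqI[of _ _ "- b"], simp_all)
  moreover have "G1\<^sup>T *\<^sub>v a \<in> C1"
    using a by (subst generator_matrix_code_eq[OF G1]) (rule imageI)
  ultimately have "G1\<^sup>T *\<^sub>v a = 0\<^sub>v n"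
    using disjoint by blast
  moreover have "G2\<^sup>T *\<^sub>v b \<in> carrier_vec n"
    using generator_matrix_dim_col[OF G2] by (intro carrier_vecI) simp
  ultimately have "G2\<^sup>T *\<^sub>v b = 0\<^sub>v n"
    using sum by simp
  then show "a = 0\<^sub>v (dim_row G1) \<and> b = 0\<^sub>v (dim_row G2)"
    using generator_matrix_kernel[OF G1 a] generator_matrix_kernel[OF G2 b]
      \<open>G1\<^sup>T *\<^sub>v a = 0\<^sub>v n\<close> by simp
qed

lemma disjoint_if_append_rows_transpose_inj:
  assumes G1: "generator_matrix n G1 C1" and G2: "generator_matrix n G2 C2"
    and inj: "inj_on ((*\<^sub>v) (G1 @\<^sub>r G2)\<^sup>T) (carrier_vec (dim_row G1 + dim_row G2))"
  shows "C1 \<inter> C2 = {0\<^sub>v n}"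
proof -
  note G1T = generator_matrix_transpose_carrier[OF G1]
    and G2T = generator_matrix_transpose_carrier[OF G2]
  have kernel: "\<forall>a\<in>carrier_vec (dim_row G1). \<forall>b\<in>carrier_vec (dim_row G2).
      G1\<^sup>T *\<^sub>v a + G2\<^sup>T *\<^sub>v b = 0\<^sub>v n \<longrightarrow> a = 0\<^sub>v (dim_row G1) \<and> b = 0\<^sub>v (dim_row G2)"
    using inj append_rows_transpose_inj_iff[OF generator_matrix_carrier[OF G1] generator_matrix_carrier[OF G2]]
    by blast
  have "x = 0\<^sub>v n" if "x \<in> C1" and "x \<in> C2" for x
  proof -
    have "x \<in> (*\<^sub>v) G1\<^sup>T ` carrier_vec (dim_row G1)" and "x \<in> (*\<^sub>v) G2\<^sup>T ` carrier_vec (dim_row G2)"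
      using that generator_matrix_code_eq[OF G1] generator_matrix_code_eq[OF G2] by simp_all
    then obtain a b where a: "a \<in> carrier_vec (dim_row G1)" "x = G1\<^sup>T *\<^sub>v a"
      and b: "b \<in> carrier_vec (dim_row G2)" "x = G2\<^sup>T *\<^sub>v b"
      by blast
    then have "G1\<^sup>T *\<^sub>v a + G2\<^sup>T *\<^sub>v (- b) = 0\<^sub>v n"
      using add_mult_mat_vec_eq_zero_iff[OF G1T G2T a(1), of "- b"] by simp
    moreover have "- b \<in> carrier_vec (dim_row G2)"
      using b(1) by simp
    ultimately have "a = 0\<^sub>v (dim_row G1)"
      using kernel a(1) by blast
    then show ?thesis
      using a(2) mult_mat_vec_zero[OF G1T] by simp
  qed
  moreover have "0\<^sub>v n \<in> C1" and "0\<^sub>v n \<in> C2"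
    by (subst generator_matrix_code_eq[OF G1], rule image_eqI[OF _ zero_carrier_vec],
        simp add: mult_mat_vec_zero[OF G1T])
      (subst generator_matrix_code_eq[OF G2], rule image_eqI[OF _ zero_carrier_vec],
        simp add: mult_mat_vec_zero[OF G2T])
  ultimately show ?thesis
    by blast
qed

section \<open>Invertibility\<close>

lemma invertible_mat_if_det_dvd_one:
  fixes A :: "'a::comm_ring_1 mat"
  assumes A: "A \<in> carrier_mat n n" and "det A dvd 1"
  shows "invertible_mat A"
proof -
  obtain w where w: "1 = det A * w"
    using assms(2) by (rule dvdE)
  define B where "B = w \<cdot>\<^sub>m adj_mat A"
  have adj: "adj_mat A \<in> carrier_mat n n"
    by (rule adj_mat(1)[OF A])
  have scaled_one: "w \<cdot>\<^sub>m (det A \<cdot>\<^sub>m 1\<^sub>m n) = 1\<^sub>m n"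
    using w by (intro eq_matI) (auto simp: mult.commute)
  have "A * B = 1\<^sub>m n"
    unfolding B_def mult_smult_distrib[OF A adj] adj_mat(2)[OF A] by (rule scaled_one)
  moreover have "B * A = 1\<^sub>m n"
    unfolding B_def mult_smult_assoc_mat[OF adj A] adj_mat(3)[OF A] by (rule scaled_one)
  moreover have "B \<in> carrier_mat n n"
    using adj by (simp add: B_def)
  ultimately show ?thesis
    using A unfolding invertible_mat_def inverts_mat_def by auto
qed

lemma invertible_mat_if_transpose_surj:
  fixes A :: "'a::comm_ring_1 mat"
  assumes A: "A \<in> carrier_mat n n" and surj: "(*\<^sub>v) A\<^sup>T ` carrier_vec n = carrier_vec n"
  shows "invertible_mat A"
proof -
  have "\<forall>j. \<exists>c. c \<in> carrier_vec n \<and> A\<^sup>T *\<^sub>v c = unit_vec n j"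
    using surj unit_vec_carrier by (metis imageE)
  then obtain cs where cs: "\<And>j. cs j \<in> carrier_vec n" "\<And>j. A\<^sup>T *\<^sub>v cs j = unit_vec n j"
    by metis
  define B where "B = mat n n (\<lambda>(i, j). cs j $ i)"
  have B: "B \<in> carrier_mat n n"
    by (simp add: B_def)
  have "A\<^sup>T * B = 1\<^sub>m n"
  proof (rule eq_matI)
    fix i j
    assume "i < dim_row (1\<^sub>m n :: 'a mat)" and "j < dim_col (1\<^sub>m n :: 'a mat)"
    then have "i < n" and "j < n"
      by simp_all
    moreover have "col B j = cs j"
      using cs(1)[of j] \<open>j < n\<close> by (auto simp: B_def vec_eq_iff)
    ultimately have "(A\<^sup>T * B) $$ (i, j) = (A\<^sup>T *\<^sub>v cs j) $ i"
      using A B by simp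
    then show "(A\<^sup>T * B) $$ (i, j) = 1\<^sub>m n $$ (i, j)"
      using cs(2) \<open>i < n\<close> \<open>j < n\<close> by simp
  qed (use A B in simp_all)
  then have "det A * det B = 1"
    using det_mult[of "A\<^sup>T" n B] det_transpose[OF A] A B by simp
  then have "det A dvd 1"
    by (metis dvdI)
  then show ?thesis
    by (rule invertible_mat_if_det_dvd_one[OF A])
qed

lemma invertible_mat_iff_square_if_transpose_surj:
  fixes M :: "'a::comm_ring_1 mat"
  assumes M: "M \<in> carrier_mat k n" and surj: "(*\<^sub>v) M\<^sup>T ` carrier_vec k = carrier_vec n"
  shows "invertible_mat M \<longleftrightarrow> k = n"
proof
  show "invertible_mat M \<Longrightarrow> k = n"
    using M unfolding invertible_mat_def by auto
  show "k = n \<Longrightarrow> invertible_mat M"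
    using invertible_mat_if_transpose_surj M surj by blast
qed

lemma invertible_mat_iff_square_if_transpose_inj:
  fixes M :: "'a::{comm_ring_1,finite} mat"
  assumes M: "M \<in> carrier_mat k n" and inj: "inj_on ((*\<^sub>v) M\<^sup>T) (carrier_vec k)"
  shows "invertible_mat M \<longleftrightarrow> k = n"
proof
  show "invertible_mat M \<Longrightarrow> k = n"
    using M unfolding invertible_mat_def by auto
  assume "k = n"
  then have "(*\<^sub>v) M\<^sup>T ` carrier_vec n = carrier_vec n"
    using mult_mat_vec_surj_iff_inj[of "M\<^sup>T" n] M inj by simp
  then show "invertible_mat M"
    using invertible_mat_if_transpose_surj M \<open>k = n\<close> by blast
qed

lemma transpose_inj_iff_square_if_surj:
  fixes M :: "'a::{comm_ring_1,finite} mat"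
  assumes M: "M \<in> carrier_mat k n" and surj: "(*\<^sub>v) M\<^sup>T ` carrier_vec k = carrier_vec n"
  shows "inj_on ((*\<^sub>v) M\<^sup>T) (carrier_vec k) \<longleftrightarrow> k = n"
  using dim_eq_if_mult_mat_vec_bij[of "M\<^sup>T" k n] mult_mat_vec_surj_iff_inj[of "M\<^sup>T" n] M surj
  by auto

section \<open>The four conditions\<close>

lemma LCP_iff_dim_row_add:
  fixes C1 C2 :: "'a::{comm_ring_1,finite} vec set"
  assumes G1: "generator_matrix n G1 C1" and G2: "generator_matrix n G2 C2"
    and full: "code_sum C1 C2 = carrier_vec n"
  shows "LCP n C1 C2 \<longleftrightarrow> dim_row G1 + dim_row G2 = n"
proof -
  have "(*\<^sub>v) (G1 @\<^sub>r G2)\<^sup>T ` carrier_vec (dim_row G1 + dim_row G2) = carrier_vec n"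
    using code_sum_eq_image_append_rows[OF G1 G2] full by simp
  note inj_iff = transpose_inj_iff_square_if_surj[OF
      carrier_append_rows[OF generator_matrix_carrier[OF G1] generator_matrix_carrier[OF G2]] this]
  show ?thesis
    using append_rows_transpose_inj_if_disjoint[OF G1 G2] disjoint_if_append_rows_transpose_inj[OF G1 G2]
      full inj_iff
    unfolding LCP_def by blast
qed

lemma invertible_append_rows_iff_if_code_sum_full:
  assumes G1: "generator_matrix n G1 C1" and G2: "generator_matrix n G2 C2"
    and full: "code_sum C1 C2 = carrier_vec n"
  shows "invertible_mat (G1 @\<^sub>r G2) \<longleftrightarrow> dim_row G1 + dim_row G2 = n"
proof (rule invertible_mat_iff_square_if_transpose_surj)
  show "G1 @\<^sub>r G2 \<in> carrier_mat (dim_row G1 + dim_row G2) n"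
    using carrier_append_rows[OF generator_matrix_carrier[OF G1] generator_matrix_carrier[OF G2]] .
  show "(*\<^sub>v) (G1 @\<^sub>r G2)\<^sup>T ` carrier_vec (dim_row G1 + dim_row G2) = carrier_vec n"
    using code_sum_eq_image_append_rows[OF G1 G2] full by simp
qed

lemma invertible_append_rows_iff_if_disjoint:
  fixes C1 C2 :: "'a::{comm_ring_1,finite} vec set"
  assumes G1: "generator_matrix n G1 C1" and G2: "generator_matrix n G2 C2"
    and disjoint: "C1 \<inter> C2 = {0\<^sub>v n}"
  shows "invertible_mat (G1 @\<^sub>r G2) \<longleftrightarrow> dim_row G1 + dim_row G2 = n"
  by (rule invertible_mat_iff_square_if_transpose_inj[OF
        carrier_append_rows[OF generator_matrix_carrier[OF G1] generator_matrix_carrier[OF G2]]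
        append_rows_transpose_inj_if_disjoint[OF G1 G2 disjoint]])

lemma Rank_q_mult_transpose_eq_iff:
  fixes G H :: "'a::{comm_ring_1,finite} mat"
  assumes "1 < q" and G: "generator_matrix n G C" and H: "generator_matrix n H D"
    and disjoint: "dual_code n C \<inter> D = {0\<^sub>v n}"
  shows "Rank_q q (H * G\<^sup>T) = Rank_q q G \<longleftrightarrow> dim_row H = dim_row G"
proof -
  have "Rank_q q (H * G\<^sup>T) = Rank_q q G \<longleftrightarrow> CARD('a) ^ dim_row H = CARD('a) ^ dim_row G"
    unfolding Rank_q_eq_iff_card_eq[OF assms(1)] card_row_module_mult_transpose[OF G H disjoint]
      generator_matrix_row_module[OF G] card_code_generator_matrix[OF G] ..
  then show ?thesis
    using one_less_card_UNIV[where 'a = 'a] by simp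
qed

theorem corollary3p18:
  fixes C1 C2 :: "'a::{comm_ring_1, finite} vec set"
    and G1 G2 H1 H2 :: "'a mat"
    and n :: nat
  assumes "local_ring TYPE('a)"
    and "local_frobenius TYPE('a)"
    and "free_code n C1" and "free_code n C2"
    and "generator_matrix n G1 C1" and "generator_matrix n G2 C2"
    and "parity_check_matrix n H1 C1" and "parity_check_matrix n H2 C2"
    and "code_sum C1 C2 = carrier_vec n"
  shows "(LCP n C1 C2 \<longleftrightarrow> invertible_mat (G1 @\<^sub>r G2))
    \<and> (invertible_mat (G1 @\<^sub>r G2) \<longleftrightarrow> invertible_mat (H1 @\<^sub>r H2))
    \<and> (invertible_mat (H1 @\<^sub>r H2) \<longleftrightarrow>
         (let q = residue_card TYPE('a) in
            Rank_q q (H2 * transpose_mat G1) = Rank_q q G1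
          \<or> Rank_q q (H1 * transpose_mat G2) = Rank_q q G2))"
proof -
  obtain s :: 'a where "s \<noteq> 0" and socle: "\<And>x. \<not> x dvd 1 \<Longrightarrow> s * x = 0"
    using local_frobenius_socle_element[OF assms(1,2)] by blast
  note G1 = assms(5) and G2 = assms(6) and full = assms(9)
  have H1: "generator_matrix n H1 (dual_code n C1)" and H2: "generator_matrix n H2 (dual_code n C2)"
    using assms(7,8) unfolding parity_check_matrix_def by auto
  have dims: "dim_row G1 + dim_row H1 = n" "dim_row G2 + dim_row H2 = n"
    using dim_generator_add_dim_parity_check[OF \<open>s \<noteq> 0\<close> socle] G1 G2 assms(7,8) by auto
  have "C1 \<subseteq> carrier_vec n" and "C2 \<subseteq> carrier_vec n"
    using assms(3,4) unfolding free_code_def linear_code_def by auto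
  then have duals: "dual_code n C1 \<inter> dual_code n C2 = {0\<^sub>v n}"
    using dual_codes_disjoint_if_code_sum_full full by blast
  have q: "1 < residue_card TYPE('a)"
    using residue_card_ge_2[OF assms(1)] by simp
  have "(let q = residue_card TYPE('a) in
      Rank_q q (H2 * transpose_mat G1) = Rank_q q G1 \<or> Rank_q q (H1 * transpose_mat G2) = Rank_q q G2)
      \<longleftrightarrow> dim_row H2 = dim_row G1 \<or> dim_row H1 = dim_row G2"
    using Rank_q_mult_transpose_eq_iff[OF q G1 H2 duals]
      Rank_q_mult_transpose_eq_iff[OF q G2 H1 duals[unfolded Int_commute[of "dual_code n C1"]]]
    by (simp add: Let_def)
  moreover have "dim_row G1 + dim_row G2 = n \<longleftrightarrow> dim_row H1 + dim_row H2 = n"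
    and "dim_row H1 + dim_row H2 = n \<longleftrightarrow> dim_row H2 = dim_row G1 \<or> dim_row H1 = dim_row G2"
    using dims by arith+
  ultimately show ?thesis
    using LCP_iff_dim_row_add[OF G1 G2 full] invertible_append_rows_iff_if_code_sum_full[OF G1 G2 full]
      invertible_append_rows_iff_if_disjoint[OF H1 H2 duals]
    by blast
qed

end
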